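(* Let $f\colon\{-1,1\}^n\times\{-1,1\}^n\to\{-1,1\}$ be given by $f(x,y)=\mathrm{MAJ}_n(x_1,\dots,x_n)\wedge\mathrm{MAJ}_n(y_1,\dots,y_n)$. Then $\mathrm{dns}(f)=n^{\Omega(\log n)}$.
   Context: Boolean values: $-1$ true, $+1$ false. $\mathrm{MAJ}_n(x)=1$ if $\sum x_i>0$, $-1$ otherwise. For $h\colon\{-1,1\}^N\to\{-1,1\}$, the threshold density $\mathrm{dns}(h)$ is the minimum $k$ such that $h(x)\equiv\mathrm{sign}\left(\sum_{i=1}^k\lambda_i\prod_{j\in S_i}x_j\right)$ for some sets $S_1,\dots,S_k\subseteq\{1,\dots,N\}$ and reals $\lambda_1,\dots,\lambda_k$. *)

theory Defs
  imports Complex_Main "HOL-Library.FuncSet"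
begin

text \<open>Boolean values are the reals \<open>-1\<close> (true) and \<open>1\<close> (false). A point of \<open>{-1,1}\<^sup>N\<close> is an
  extensional function on \<open>{1..N}\<close>.\<close>

definition cube :: "nat \<Rightarrow> (nat \<Rightarrow> real) set" where
  "cube N = {1..N} \<rightarrow>\<^sub>E {-1, 1}"

definition MAJ :: "nat \<Rightarrow> (nat \<Rightarrow> real) \<Rightarrow> real" where
  "MAJ n x = (if (\<Sum>i=1..n. x i) > 0 then 1 else -1)"

definition AND :: "real \<Rightarrow> real \<Rightarrow> real" where
  "AND a b = (if a = -1 \<and> b = -1 then -1 else 1)"

text \<open>Since \<open>sgn 0 = 0\<close>, the representing polynomial cannot vanish on the cube.\<close>

definition sign_representable :: "nat \<Rightarrow> ((nat \<Rightarrow> real) \<Rightarrow> real) \<Rightarrow> nat \<Rightarrow> bool" where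
  "sign_representable N h k \<longleftrightarrow>
     (\<exists>(S :: nat \<Rightarrow> nat set) (l :: nat \<Rightarrow> real).
        (\<forall>i\<in>{1..k}. S i \<subseteq> {1..N}) \<and>
        (\<forall>x\<in>cube N. h x = sgn (\<Sum>i=1..k. l i * (\<Prod>j\<in>S i. x j))))"

definition dns :: "nat \<Rightarrow> ((nat \<Rightarrow> real) \<Rightarrow> real) \<Rightarrow> nat" where
  "dns N h = (LEAST k. sign_representable N h k)"

text \<open>A pair \<open>(x, y)\<close> in \<open>{-1,1}\<^sup>n \<times> {-1,1}\<^sup>n\<close> is identified with the point
  \<open>z = (x\<^sub>1, \<dots>, x\<^sub>n, y\<^sub>1, \<dots>, y\<^sub>n)\<close> of \<open>{-1,1}\<^bsup>2n\<^esup>\<close>.\<close>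

definition maj_and_maj :: "nat \<Rightarrow> (nat \<Rightarrow> real) \<Rightarrow> real" where
  "maj_and_maj n z = AND (MAJ n z) (MAJ n (\<lambda>i. z (n + i)))"

end

theory Submission
  imports Defs "HOL-Computational_Algebra.Polynomial" "HOL-Analysis.Infinite_Products"
begin

text \<open>
  Suppose the function is the sign of a combination of \<open>K\<close> parities. Group the variables into pairs
  and the pairs into groups of \<open>k\<close>, and select one pair of each group. The two variables of a
  selected pair are set equal, those of any other pair are set opposite, so the other pairs do not
  influence the majorities. Averaging over the signs of the unselected pairs kills every parity that
  meets one of them in a single variable; since a parity that survives as a monomial of degree above
  \<open>d\<close> does so for a fraction at most \<open>k\<^bsup>-(d+1)\<^esup>\<close> of the selections, if \<open>K < k\<^bsup>d+1\<^esup>\<close> then some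
  selection leaves only monomials of degree at most \<open>d\<close>. Averaging over the points with given sums
  \<open>s, t\<close> of the selected variables yields \<open>F(s, t)\<close> of degree at most \<open>d\<close> in each variable that is
  negative iff \<open>s\<close> and \<open>t\<close> are both negative.

  Such an \<open>F\<close> does not exist on the nodes \<open>\<plusminus>1024\<^sup>i\<close>, \<open>i \<le> d\<close>. There are weights with
  \<open>\<Sum> N\<^sub>i p(x\<^sub>i) = \<Sum> M\<^sub>i p(x\<^sub>i) + \<Sum> Z\<^sub>i p(-x\<^sub>i)\<close> for all \<open>p\<close> of degree at most \<open>d\<close>, where \<open>N \<ge> 0\<close>, \<open>M > 0\<close> and
  \<open>Z \<ge> 3/4 M\<close>. Applied to the reflected \<open>F\<close> in both variables, this bounds the \<open>M\<otimes>M\<close>-mass \<open>E\<close> of \<open>-F\<close>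
  on the negative quadrant from below by \<open>3/4\<close> of the sum of the masses of \<open>F\<close> on the two mixed
  quadrants; applied in one variable it bounds each of these below by \<open>3/4 E\<close>. Hence \<open>E > 9/8 E\<close>.

  With \<open>k = 2\<^sup>d\<close> and \<open>n \<approx> 2\<^bsup>11d\<^esup>\<close> this gives \<open>K \<ge> 2\<^bsup>d(d+1)\<^esup>\<close>, which is \<open>n\<^bsup>\<Omega>(log n)\<^esup>\<close>.
\<close>

section \<open>Existence of sign representations\<close>

text \<open>The Fourier expansion over all parities equals \<open>h\<close>, and \<open>h\<close> is
  its own sign since its values are \<open>-1\<close> and \<open>1\<close>. This ensures that the
  \<open>LEAST\<close> in \<open>dns\<close> is attained.\<close>

lemma ex_sign_representable:
  assumes "\<And>x. x \<in> cube N \<Longrightarrow> h x \<in> {-1, 1}"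
  shows "\<exists>k. sign_representable N h k"
proof -
  define c where "c S = (\<Sum>a\<in>cube N. h a * (\<Prod>j\<in>S. a j)) / 2 ^ N" for S
  have fin: "finite (cube N)"
    unfolding cube_def by (intro finite_PiE) auto
  have expand: "h x = (\<Sum>S\<in>Pow {1..N}. c S * (\<Prod>j\<in>S. x j))" if x: "x \<in> cube N" for x
  proof -
    \<comment> \<open>Expanding this product over subsets gives the orthogonality relation behind
      Fourier inversion.\<close>
    have ind: "(\<Prod>j\<in>{1..N}. a j * x j + 1) = (if a = x then 2 ^ N else 0)" if a: "a \<in> cube N" for a
    proof (cases "a = x")
      case True
      have "a j * x j + 1 = 2" if "j \<in> {1..N}" for j
        using PiE_mem[OF x[unfolded cube_def] that] True by auto
      then show ?thesis using True by simp
    next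
      case False
      then obtain j where j: "j \<in> {1..N}" "a j \<noteq> x j"
        using a x unfolding cube_def by (meson PiE_ext)
      then have "a j * x j + 1 = 0"
        using PiE_mem[OF x[unfolded cube_def] j(1)] PiE_mem[OF a[unfolded cube_def] j(1)] by auto
      then show ?thesis using False j(1) by (auto intro!: prod_zero)
    qed
    have "(\<Sum>S\<in>Pow {1..N}. c S * (\<Prod>j\<in>S. x j))
        = (\<Sum>S\<in>Pow {1..N}. \<Sum>a\<in>cube N. h a / 2 ^ N * (\<Prod>j\<in>S. a j * x j))"
      by (simp add: c_def prod.distrib sum_distrib_left sum_distrib_right sum_divide_distrib mult_ac)
    also have "\<dots> = (\<Sum>a\<in>cube N. h a / 2 ^ N * (\<Prod>j\<in>{1..N}. a j * x j + 1))"
      by (subst sum.swap) (simp add: prod_add sum_distrib_left)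
    also have "\<dots> = (\<Sum>a\<in>cube N. if a = x then h x else 0)"
      by (intro sum.cong refl) (simp add: ind del: One_nat_def)
    also have "\<dots> = h x" using fin x by simp
    finally show ?thesis by simp
  qed
  obtain S where S: "bij_betw S {1..card (Pow {1..N})} (Pow {1..N})"
    using ex_bij_betw_nat_finite_1[of "Pow {1..N}"] by auto
  have "h x = sgn (\<Sum>i=1..card (Pow {1..N}). c (S i) * (\<Prod>j\<in>S i. x j))" if "x \<in> cube N" for x
    using sum.reindex_bij_betw[OF S, of "\<lambda>S. c S * (\<Prod>j\<in>S. x j)"] expand[OF that] assms[OF that]
    by auto
  moreover have "\<forall>i\<in>{1..card (Pow {1..N})}. S i \<subseteq> {1..N}"
    using bij_betwE[OF S] by auto
  ultimately show ?thesis
    unfolding sign_representable_def by (intro exI[of _ "card (Pow {1..N})"] exI[of _ S] exI[of _ "\<lambda>i. c (S i)"]) auto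
qed

section \<open>A measure annihilating low-degree polynomials\<close>

text \<open>The sum is the coefficient of degree \<open>card X - 1\<close> in the Lagrange
  interpolant of \<open>p\<close> on \<open>X\<close>. That interpolant is \<open>p\<close> itself,
  whose degree is smaller.\<close>

lemma divided_difference_eq_0:
  fixes X :: "'a::field set"
  assumes fin: "finite X" and deg: "degree p + 1 < card X"
  shows "(\<Sum>x\<in>X. poly p x / (\<Prod>y\<in>X - {x}. x - y)) = 0"
proof -
  define l where "l x = (\<Prod>y\<in>X - {x}. [:- y, 1:])" for x :: 'a
  define D where "D x = (\<Prod>y\<in>X - {x}. x - y)" for x :: 'a
  define L where "L = (\<Sum>x\<in>X. smult (poly p x / D x) (l x))"
  have degl: "degree (l x) = card X - 1" if "x \<in> X" for x
    using that fin by (simp add: l_def degree_prod_eq_sum_degree)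
  have lead: "coeff (l x) (card X - 1) = 1" if "x \<in> X" for x
    using degl[OF that] lead_coeff_prod[of "\<lambda>y. [:- y, 1:]" "X - {x}"] by (simp add: l_def)
  have D: "D x \<noteq> 0" for x using fin by (auto simp: D_def)
  have l_eval: "poly (l x) z = (if z = x then D x else 0)" if "x \<in> X" "z \<in> X" for x z
    using that fin by (auto simp: l_def D_def poly_prod intro!: prod.cong prod_zero)
  have "poly L z = poly p z" if "z \<in> X" for z
  proof -
    have "poly L z = (\<Sum>x\<in>X. if x = z then poly p z else 0)"
      unfolding L_def poly_sum using that D by (intro sum.cong) (auto simp: l_eval)
    then show ?thesis using that fin by simp
  qed
  moreover have "degree L \<le> card X - 1"
    unfolding L_def by (intro degree_sum_le fin) (use degl in \<open>auto intro: order.trans[OF degree_smult_le]\<close>)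
  ultimately have "L = p"
    using deg by (intro poly_eqI_degree[of X]) auto
  have "(\<Sum>x\<in>X. poly p x / D x) = coeff L (card X - 1)"
    unfolding L_def coeff_sum by (intro sum.cong refl) (simp add: lead del: One_nat_def)
  also have "\<dots> = 0" using deg \<open>L = p\<close> by (simp add: coeff_eq_0)
  finally show ?thesis by (simp add: D_def)
qed

lemma moment_sum_eq_0:
  fixes x :: "nat \<Rightarrow> real"
  assumes inj: "inj_on x {..d}" and i: "i < d"
  shows "(\<Sum>k\<le>d. x k ^ i / (\<Prod>l\<in>{..d} - {k}. x k - x l)) = 0"
proof -
  have "(\<Sum>z\<in>x ` {..d}. poly (monom 1 i) z / (\<Prod>y\<in>x ` {..d} - {z}. z - y)) = 0"
    using i card_image[OF inj] by (intro divided_difference_eq_0) (auto simp: degree_monom_eq)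
  also have "(\<Sum>z\<in>x ` {..d}. poly (monom 1 i) z / (\<Prod>y\<in>x ` {..d} - {z}. z - y))
      = (\<Sum>k\<le>d. x k ^ i / (\<Prod>y\<in>x ` {..d} - {x k}. x k - y))"
    by (simp add: sum.reindex[OF inj] poly_monom)
  also have "\<dots> = (\<Sum>k\<le>d. x k ^ i / (\<Prod>l\<in>{..d} - {k}. x k - x l))"
  proof (intro sum.cong refl)
    fix k assume k: "k \<in> {..d}"
    have im: "x ` {..d} - {x k} = x ` ({..d} - {k})"
      using inj k by (auto simp: inj_on_def)
    have "(\<Prod>y\<in>x ` {..d} - {x k}. x k - y) = (\<Prod>l\<in>{..d} - {k}. x k - x l)"
      unfolding im by (subst prod.reindex) (auto intro: inj_on_subset[OF inj])
    then show "x k ^ i / (\<Prod>y\<in>x ` {..d} - {x k}. x k - y) = x k ^ i / (\<Prod>l\<in>{..d} - {k}. x k - x l)"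
      by simp
  qed
  finally show ?thesis .
qed

text \<open>If t is the smaller of \<open>1024 ^ k\<close> and \<open>32 ^ (2 * i + 1)\<close>
  divided by the larger, the factors have ratio (1 - t) / (1 + t) >= 1 - 2t. The values 2t, called
  \<open>a i\<close> below, decay geometrically on both sides of \<open>k\<close>, so the
  Weierstrass product inequality applies.\<close>

lemma reflected_node_product_ratio:
  fixes k d :: nat
  shows "3 / 4 * (\<Prod>i<d. 1024 ^ k + 32 ^ (2 * i + 1)) \<le> (\<Prod>i<d. \<bar>32 ^ (2 * i + 1) - 1024 ^ k\<bar> :: real)"
proof -
  define a :: "nat \<Rightarrow> real" where
    "a i = (if i < k then 2 / 32 * (1 / 1024) ^ (k - Suc i) else 2 / 32 * (1 / 1024) ^ (i - k))" for i
  have sq: "(32::real) ^ (2 * i + 1) = 32 * 1024 ^ i" for i by (simp add: power_mult)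
  have a01: "a i \<in> {0..1}" for i
    using power_le_one[of "1 / 1024 :: real" "k - Suc i"] power_le_one[of "1 / 1024 :: real" "i - k"]
    by (auto simp: a_def)
  have factor: "(1 - a i) * (1024 ^ k + 32 ^ (2 * i + 1)) \<le> \<bar>32 ^ (2 * i + 1) - 1024 ^ k\<bar>" for i
  proof (cases "i < k")
    case True
    define j where "j = k - Suc i"
    have k: "k = Suc (i + j)" using True by (simp add: j_def)
    define u v :: real where "u = 1024 ^ i" and "v = 1024 ^ j"
    have uv: "u \<ge> 1" "v \<ge> 1" by (auto simp: u_def v_def)
    have a: "a i = 2 / 32 / v" by (simp add: a_def True j_def v_def power_divide)
    have k': "(1024::real) ^ k = 1024 * u * v" by (simp add: k u_def v_def power_add)
    have "u \<le> u * v" using uv by simp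
    then have "\<bar>32 * u - 1024 * u * v\<bar> = 1024 * u * v - 32 * u" using uv by simp
    moreover have "(1 - a i) * (1024 * u * v + 32 * u) = 1024 * u * v + 32 * u - 64 * u - 2 * u / v"
      using uv by (simp add: a field_simps)
    ultimately show ?thesis unfolding sq k' u_def[symmetric] using uv by simp
  next
    case False
    define j where "j = i - k"
    have i: "i = k + j" using False by (simp add: j_def)
    define u v :: real where "u = 1024 ^ k" and "v = 1024 ^ j"
    have uv: "u \<ge> 1" "v \<ge> 1" by (auto simp: u_def v_def)
    have a: "a i = 2 / 32 / v" by (simp add: a_def False j_def v_def power_divide)
    have i': "(1024::real) ^ i = u * v" by (simp add: i u_def v_def power_add)
    have "u \<le> u * v" using uv by simp
    then have "\<bar>32 * (u * v) - u\<bar> = 32 * (u * v) - u" using uv by linarith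
    moreover have "(1 - a i) * (u + 32 * (u * v)) = u + 32 * (u * v) - 2 * u - 2 / 32 * u / v"
      using uv by (simp add: a field_simps)
    ultimately show ?thesis unfolding sq i' u_def[symmetric] using uv by simp
  qed
  have geo: "(\<Sum>i<n. (1 / 1024 :: real) ^ i) \<le> 1024 / 1023" for n
    by (simp add: sum_gp_strict)
  \<comment> \<open>The longer range can be split at \<open>k\<close> even if
    \<open>d < k\<close>.\<close>
  have "(\<Sum>i<d. a i) \<le> (\<Sum>i<k + d. a i)"
    using a01 by (intro sum_mono2) auto
  also have "\<dots> = (\<Sum>i<k. a i) + (\<Sum>i<d. a (k + i))"
    by (induction d) simp_all
  also have "(\<Sum>i<k. a i) = 2 / 32 * (\<Sum>i<k. (1 / 1024) ^ i)"
    unfolding sum.nat_diff_reindex[of "\<lambda>i. (1 / 1024) ^ i" k, symmetric]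
    by (simp add: a_def sum_distrib_left)
  also have "(\<Sum>i<d. a (k + i)) = 2 / 32 * (\<Sum>i<d. (1 / 1024) ^ i)"
    by (simp add: a_def sum_distrib_left)
  finally have "(\<Sum>i<d. a i) \<le> 1 / 4"
    using geo[of k] geo[of d] by linarith
  then have "3 / 4 \<le> (\<Prod>i<d. 1 - a i)"
    using Weierstrass_prod_ineq[of "{..<d}" a] a01 by force
  then have "3 / 4 * (\<Prod>i<d. 1024 ^ k + 32 ^ (2 * i + 1))
      \<le> (\<Prod>i<d. 1 - a i) * (\<Prod>i<d. 1024 ^ k + 32 ^ (2 * i + 1))"
    by (intro mult_right_mono prod_nonneg) auto
  also have "\<dots> \<le> (\<Prod>i<d. \<bar>32 ^ (2 * i + 1) - 1024 ^ k\<bar>)"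
    unfolding prod.distrib[symmetric]
    using a01 factor by (intro prod_mono conjI mult_nonneg_nonneg) auto
  finally show ?thesis .
qed

text \<open>Exactly the \<open>d - k\<close> factors with \<open>l > k\<close> are negative.\<close>

lemma prod_diff_sign:
  fixes y :: "nat \<Rightarrow> real"
  assumes "strict_mono y" "k \<le> d"
  shows "(\<Prod>l\<in>{..d} - {k}. y k - y l) = (-1) ^ (d - k) * (\<Prod>l\<in>{..d} - {k}. \<bar>y k - y l\<bar>)"
proof -
  have split: "{..d} - {k} = {..<k} \<union> {k<..d}" using assms(2) by auto
  have "(\<Prod>l\<in>{k<..d}. y k - y l) = (\<Prod>l\<in>{k<..d}. - \<bar>y k - y l\<bar>)"
    using strict_monoD[OF assms(1)] by (intro prod.cong) (auto simp: abs_if)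
  also have "\<dots> = (-1) ^ (d - k) * (\<Prod>l\<in>{k<..d}. \<bar>y k - y l\<bar>)"
    by (subst prod_uminus) auto
  finally have 1: "(\<Prod>l\<in>{k<..d}. y k - y l) = (-1) ^ (d - k) * (\<Prod>l\<in>{k<..d}. \<bar>y k - y l\<bar>)" .
  have 2: "(\<Prod>l\<in>{..<k}. y k - y l) = (\<Prod>l\<in>{..<k}. \<bar>y k - y l\<bar>)"
    using strict_monoD[OF assms(1)] by (intro prod.cong) (auto simp: abs_if not_less less_imp_le)
  have disj: "{..<k} \<inter> {k<..d} = {}" by auto
  show ?thesis unfolding split
    by (simp only: prod.union_disjoint[OF finite_lessThan finite_greaterThanAtMost disj] 1 2) (simp add: mult_ac)
qed

text \<open>Odd powers of 32 separate consecutive powers of 1024, so exactly the \<open>k\<close>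
  factors with \<open>i < k\<close> are negative.\<close>

lemma interlacing_prod_sign:
  assumes "k \<le> d"
  shows "(\<Prod>i<d. 32 ^ (2 * i + 1) - 1024 ^ k :: real) = (-1) ^ k * (\<Prod>i<d. \<bar>32 ^ (2 * i + 1) - 1024 ^ k\<bar>)"
proof -
  have pow: "(1024::real) ^ k = 32 ^ (2 * k)" by (simp add: power_mult)
  have split: "{..<d} = {..<k} \<union> {k..<d}" using assms by auto
  have "(\<Prod>i<k. 32 ^ (2 * i + 1) - 1024 ^ k :: real) = (\<Prod>i<k. - \<bar>32 ^ (2 * i + 1) - 1024 ^ k\<bar>)"
    unfolding pow by (intro prod.cong refl) (auto simp: abs_if simp del: power_Suc)
  also have "\<dots> = (-1) ^ k * (\<Prod>i<k. \<bar>32 ^ (2 * i + 1) - 1024 ^ k\<bar>)"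
    by (subst prod_uminus) auto
  finally have 1: "(\<Prod>i<k. 32 ^ (2 * i + 1) - 1024 ^ k :: real) = (-1) ^ k * (\<Prod>i<k. \<bar>32 ^ (2 * i + 1) - 1024 ^ k\<bar>)" .
  have 2: "(\<Prod>i\<in>{k..<d}. 32 ^ (2 * i + 1) - 1024 ^ k :: real) = (\<Prod>i\<in>{k..<d}. \<bar>32 ^ (2 * i + 1) - 1024 ^ k\<bar>)"
    unfolding pow by (intro prod.cong refl) (auto simp: abs_if simp del: power_Suc)
  have disj: "{..<k} \<inter> {k..<d} = {}" by auto
  show ?thesis unfolding split
    by (simp only: prod.union_disjoint[OF finite_lessThan finite_atLeastLessThan disj] 1 2)
qed

text \<open>The odd part of \<open>p\<close> divided by the variable is a polynomial of degree below
  \<open>d\<close> in the squared variable. Its divided difference over the \<open>d + 1\<close>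
  squared nodes therefore vanishes.\<close>

lemma odd_part_divided_difference:
  fixes x :: "nat \<Rightarrow> real"
  assumes pos: "\<And>k. x k > 0" and mono: "strict_mono x" and deg: "degree p \<le> 2 * d"
  shows "(\<Sum>k\<le>d. (poly p (x k) - poly p (- x k)) / (2 * x k * (\<Prod>l\<in>{..d} - {k}. (x k)\<^sup>2 - (x l)\<^sup>2))) = 0"
proof -
  define D where "D k = (\<Prod>l\<in>{..d} - {k}. (x k)\<^sup>2 - (x l)\<^sup>2)" for k
  have inj: "inj_on (\<lambda>k. (x k)\<^sup>2) {..d}"
  proof -
    have "strict_mono (\<lambda>k. (x k)\<^sup>2)"
      using pos mono by (auto simp: strict_mono_def intro!: power_strict_mono less_imp_le)
    then show ?thesis using strict_mono_imp_inj_on inj_on_subset by blast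
  qed
  have mom: "(\<Sum>k\<le>d. (x k ^ i - (- x k) ^ i) / (2 * x k * D k)) = 0" if "i \<le> 2 * d" for i
  proof (cases "even i")
    case True
    then show ?thesis by simp
  next
    case False
    then obtain j where j: "i = 2 * j + 1" by (elim oddE)
    then have "j < d" using that by simp
    from moment_sum_eq_0[OF inj this]
    have "(\<Sum>k\<le>d. ((x k)\<^sup>2) ^ j / D k) = 0" by (simp add: D_def)
    moreover have "(x k ^ i - (- x k) ^ i) / (2 * x k * D k) = ((x k)\<^sup>2) ^ j / D k" for k
      using pos[of k] by (simp add: j power_mult)
    ultimately show ?thesis by simp
  qed
  have "(\<Sum>k\<le>d. (poly p (x k) - poly p (- x k)) / (2 * x k * D k))
      = (\<Sum>k\<le>d. \<Sum>i\<le>degree p. coeff p i * ((x k ^ i - (- x k) ^ i) / (2 * x k * D k)))"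
    by (simp add: poly_altdef sum_subtractf[symmetric] sum_divide_distrib right_diff_distrib)
  also have "\<dots> = (\<Sum>i\<le>degree p. coeff p i * (\<Sum>k\<le>d. (x k ^ i - (- x k) ^ i) / (2 * x k * D k)))"
    by (subst sum.swap) (simp add: sum_distrib_left)
  also have "\<dots> = 0" using mom deg by (intro sum.neutral) auto
  finally show ?thesis by (simp add: D_def)
qed

text \<open>The bound \<open>2 * d\<close> in the preceding identity leaves room for a multiplier of
  degree \<open>d\<close>, whose values at the nodes are absorbed into the weights.\<close>

lemma ex_alternating_annihilator:
  fixes d :: nat
  obtains M Z :: "nat \<Rightarrow> real"
  where "\<And>k. M k > 0" "\<And>k. 3 / 4 * M k \<le> Z k"
    "\<And>p. degree p \<le> d \<Longrightarrow>
      (\<Sum>k\<le>d. (-1) ^ k * M k * poly p (1024 ^ k)) = (\<Sum>k\<le>d. Z k * poly p (- (1024 ^ k)))"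
proof -
  define x :: "nat \<Rightarrow> real" where "x k = 1024 ^ k" for k
  \<comment> \<open>The roots of \<open>h\<close> interlace the negative nodes, so \<open>h\<close> alternates in sign there and is positive
    at the positive nodes: dividing by the alternating products of a divided difference, all
    negative nodes get weights of one sign and the weights of the positive nodes alternate.\<close>
  define h :: "real poly" where "h = (\<Prod>i<d. [:32 ^ (2 * i + 1), 1:])"
  define D where "D k = 2 * x k * (\<Prod>l\<in>{..d} - {k}. \<bar>(x k)\<^sup>2 - (x l)\<^sup>2\<bar>)" for k
  define M where "M k = (\<Prod>i<d. 1024 ^ k + 32 ^ (2 * i + 1)) / D k" for k
  define Z where "Z k = (\<Prod>i<d. \<bar>32 ^ (2 * i + 1) - 1024 ^ k\<bar>) / D k" for k
  have xpos: "x k > 0" for k by (simp add: x_def)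
  have xmono: "strict_mono x" by (auto simp: strict_mono_def x_def)
  have sqmono: "strict_mono (\<lambda>k. (x k)\<^sup>2)"
    using xpos xmono by (auto simp: strict_mono_def intro!: power_strict_mono less_imp_le)
  have Dpos: "D k > 0" for k
    unfolding D_def using xpos strict_mono_eq[OF sqmono] by (intro mult_pos_pos prod_pos) auto
  have "M k > 0" for k
    unfolding M_def by (intro divide_pos_pos Dpos prod_pos) (auto intro: add_pos_pos)
  moreover have "3 / 4 * M k \<le> Z k" for k
    using divide_right_mono[OF reflected_node_product_ratio[of k d] less_imp_le[OF Dpos[of k]]]
    by (simp add: M_def Z_def)
  moreover have "(\<Sum>k\<le>d. (-1) ^ k * M k * poly p (1024 ^ k)) = (\<Sum>k\<le>d. Z k * poly p (- (1024 ^ k)))"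
    if deg: "degree p \<le> d" for p
  proof -
    have "degree h \<le> d"
      unfolding h_def using degree_prod_sum_le[of "{..<d}" "\<lambda>i. [:32 ^ (2 * i + 1), 1::real:]"] by simp
    then have "degree (p * h) \<le> 2 * d" using deg degree_mult_le[of p h] by linarith
    from odd_part_divided_difference[OF xpos xmono this]
    have 0: "(\<Sum>k\<le>d. (poly (p * h) (x k) - poly (p * h) (- x k))
        / (2 * x k * (\<Prod>l\<in>{..d} - {k}. (x k)\<^sup>2 - (x l)\<^sup>2))) = 0" .
    \<comment> \<open>The denominator has sign \<open>(-1) ^ (d - k)\<close>. At a negative node the
      sign \<open>(-1) ^ k\<close> of \<open>h\<close> turns this into the constant
      \<open>(-1) ^ d\<close>; at a positive node the alternation stays.\<close>
    have "(poly (p * h) (x k) - poly (p * h) (- x k)) / (2 * x k * (\<Prod>l\<in>{..d} - {k}. (x k)\<^sup>2 - (x l)\<^sup>2))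
        = (-1) ^ d * ((-1) ^ k * M k * poly p (1024 ^ k) - Z k * poly p (- (1024 ^ k)))"
      if k: "k \<le> d" for k
    proof -
      have D: "2 * x k * (\<Prod>l\<in>{..d} - {k}. (x k)\<^sup>2 - (x l)\<^sup>2) = (-1) ^ (d - k) * D k"
        unfolding D_def by (subst prod_diff_sign[OF sqmono k]) simp
      have hp: "poly h (x k) = M k * D k"
        using Dpos[of k] by (simp add: h_def M_def poly_prod x_def add.commute)
      have hn: "poly h (- x k) = (-1) ^ k * Z k * D k"
        using Dpos[of k] interlacing_prod_sign[OF k] by (simp add: h_def Z_def poly_prod x_def)
      have s: "(-1 :: real) ^ d = (-1) ^ (d - k) * (-1) ^ k" using k by (simp flip: power_add)
      have inv: "a / ((-1) ^ (d - k) * D k) = (-1) ^ (d - k) * a / D k" for a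
        by (cases "even (d - k)") auto
      show ?thesis
        unfolding D inv poly_mult hp hn s using Dpos[of k]
        by (cases "even k") (auto simp: x_def field_simps)
    qed
    with 0 have "(-1) ^ d * (\<Sum>k\<le>d. (-1) ^ k * M k * poly p (1024 ^ k) - Z k * poly p (- (1024 ^ k))) = 0"
      by (simp add: sum_distrib_left)
    then show ?thesis by (simp add: sum_subtractf)
  qed
  ultimately show ?thesis using that by blast
qed

section \<open>Sign patterns of bivariate polynomials\<close>

lemma no_low_degree_intersection_sign_pattern:
  fixes p r :: "'i \<Rightarrow> real poly" and c :: "'i \<Rightarrow> real"
  assumes fin: "finite I"
    and degp: "\<And>i. i \<in> I \<Longrightarrow> degree (p i) \<le> d" and degr: "\<And>i. i \<in> I \<Longrightarrow> degree (r i) \<le> d"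
    and F_def: "\<And>x y. F x y = (\<Sum>i\<in>I. c i * poly (p i) x * poly (r i) y)"
    and neg: "\<And>k l. k \<le> d \<Longrightarrow> l \<le> d \<Longrightarrow> F (- (1024 ^ k)) (- (1024 ^ l)) < 0"
    and pos: "\<And>k l. k \<le> d \<Longrightarrow> l \<le> d \<Longrightarrow> F (1024 ^ k) (1024 ^ l) > 0"
      "\<And>k l. k \<le> d \<Longrightarrow> l \<le> d \<Longrightarrow> F (1024 ^ k) (- (1024 ^ l)) > 0"
      "\<And>k l. k \<le> d \<Longrightarrow> l \<le> d \<Longrightarrow> F (- (1024 ^ k)) (1024 ^ l) > 0"
  shows False
proof -
  obtain M Z :: "nat \<Rightarrow> real" where M: "\<And>k. M k > 0" and MZ: "\<And>k. 3 / 4 * M k \<le> Z k"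
    and ann: "\<And>q. degree q \<le> d \<Longrightarrow>
      (\<Sum>k\<le>d. (-1) ^ k * M k * poly q (1024 ^ k)) = (\<Sum>k\<le>d. Z k * poly q (- (1024 ^ k)))"
    using ex_alternating_annihilator by blast
  \<comment> \<open>\<open>N \<ge> 0\<close> on the positive nodes has the same moments as \<open>M\<close> on the positive nodes plus \<open>Z\<close> on
    the negative ones.\<close>
  define N where "N k = (1 + (-1) ^ k) * M k" for k
  have N0: "N k \<ge> 0" for k using M[of k] by (cases "even k") (auto simp: N_def)
  have Z: "Z k > 0" for k using M[of k] MZ[of k] by linarith
  have balance: "(\<Sum>k\<le>d. N k * poly q (1024 ^ k)) = (\<Sum>k\<le>d. M k * poly q (1024 ^ k)) + (\<Sum>k\<le>d. Z k * poly q (- (1024 ^ k)))"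
    if "degree q \<le> d" for q
    using ann[OF that] by (simp add: N_def distrib_right sum.distrib)
  have balance': "(\<Sum>k\<le>d. N k * poly q (- (1024 ^ k))) = (\<Sum>k\<le>d. M k * poly q (- (1024 ^ k))) + (\<Sum>k\<le>d. Z k * poly q (1024 ^ k))"
    if "degree q \<le> d" for q
    using balance[of "q \<circ>\<^sub>p [:0, -1:]"] that by (simp add: degree_pcompose poly_pcompose)
  define u v where "u k = (1024 :: real) ^ k" and "v k = - ((1024 :: real) ^ k)" for k
  have Fx: "\<exists>q. degree q \<le> d \<and> (\<forall>x. F x y = poly q x)" for y
    using degp by (intro exI[of _ "\<Sum>i\<in>I. smult (c i * poly (r i) y) (p i)"] conjI degree_sum_le fin)
      (auto simp: F_def poly_sum mult_ac intro: order.trans[OF degree_smult_le])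
  have Fy: "\<exists>q. degree q \<le> d \<and> (\<forall>y. F x y = poly q y)" for x
    using degr by (intro exI[of _ "\<Sum>i\<in>I. smult (c i * poly (p i) x) (r i)"] conjI degree_sum_le fin)
      (auto simp: F_def poly_sum mult_ac intro: order.trans[OF degree_smult_le])
  have x1: "(\<Sum>k\<le>d. N k * F (u k) y) = (\<Sum>k\<le>d. M k * F (u k) y) + (\<Sum>k\<le>d. Z k * F (v k) y)" for y
    using Fx[of y] balance by (auto simp: u_def v_def)
  have x2: "(\<Sum>k\<le>d. N k * F (v k) y) = (\<Sum>k\<le>d. M k * F (v k) y) + (\<Sum>k\<le>d. Z k * F (u k) y)" for y
    using Fx[of y] balance' by (auto simp: u_def v_def)
  have y1: "(\<Sum>k\<le>d. N k * F x (u k)) = (\<Sum>k\<le>d. M k * F x (u k)) + (\<Sum>k\<le>d. Z k * F x (v k))" for x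
    using Fy[of x] balance by (auto simp: u_def v_def)
  have y2: "(\<Sum>k\<le>d. N k * F x (v k)) = (\<Sum>k\<le>d. M k * F x (v k)) + (\<Sum>k\<le>d. Z k * F x (u k))" for x
    using Fy[of x] balance' by (auto simp: u_def v_def)
  \<comment> \<open>\<open>T\<close> integrates \<open>F\<close> against a product of two weights;
    \<open>T1\<close> and \<open>T2\<close> expose one variable at a time, so that the one-variable
    identities apply.\<close>
  define T where "T g h a b = (\<Sum>k\<le>d. \<Sum>l\<le>d. g k * h l * F (a k) (b l))" for g h a b :: "nat \<Rightarrow> real"
  have T1: "T g h a b = (\<Sum>k\<le>d. g k * (\<Sum>l\<le>d. h l * F (a k) (b l)))" for g h a b
    by (simp add: T_def sum_distrib_left mult_ac)
  have T2: "T g h a b = (\<Sum>l\<le>d. h l * (\<Sum>k\<le>d. g k * F (a k) (b l)))" for g h a b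
    unfolding T_def by (subst sum.swap) (simp add: sum_distrib_left mult_ac)
  have NN: "T N N v v = T M M v v + T M Z v u + T Z M u v + T Z Z u u"
  proof -
    have "T N N v v = T M N v v + T Z N u v"
      unfolding T2 x2 by (simp add: distrib_left sum.distrib)
    also have "T M N v v = T M M v v + T M Z v u"
      unfolding T1 y2 by (simp add: distrib_left sum.distrib)
    also have "T Z N u v = T Z M u v + T Z Z u u"
      unfolding T1 y2 by (simp add: distrib_left sum.distrib)
    finally show ?thesis by simp
  qed
  have NM: "T N M u v = T M M u v + T Z M v v"
    unfolding T2 x1 by (simp add: distrib_left sum.distrib)
  have MN: "T M N v u = T M M v u + T M Z v v"
    unfolding T1 y1 by (simp add: distrib_left sum.distrib)
  have sgn: "F (v k) (v l) < 0" "F (u k) (v l) > 0" "F (v k) (u l) > 0" "F (u k) (u l) > 0"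
    if "k \<le> d" "l \<le> d" for k l
    using neg pos that by (auto simp: u_def v_def)
  have ge0: "T N M u v \<ge> 0" "T M N v u \<ge> 0"
    unfolding T_def using sgn by (auto intro!: sum_nonneg mult_nonneg_nonneg N0 less_imp_le[OF M] intro: less_imp_le)
  have "T N N v v \<le> 0"
    unfolding T_def using sgn by (auto intro!: sum_nonpos mult_nonneg_nonpos mult_nonneg_nonneg N0 intro: less_imp_le)
  moreover have "T Z Z u u > 0"
    unfolding T_def using sgn Z by (intro sum_pos) (auto intro!: mult_pos_pos)
  moreover have "T M Z v u \<ge> 3 / 4 * T M M v u"
    unfolding T_def sum_distrib_left
  proof (intro sum_mono)
    fix k l assume "k \<in> {..d}" "l \<in> {..d}"
    then have "M k * F (v k) (u l) \<ge> 0" using M[of k] sgn(3)[of k l] by simp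
    from mult_right_mono[OF MZ[of l] this] show "3 / 4 * (M k * M l * F (v k) (u l)) \<le> M k * Z l * F (v k) (u l)"
      by (simp add: mult_ac)
  qed
  moreover have "T Z M u v \<ge> 3 / 4 * T M M u v"
    unfolding T_def sum_distrib_left
  proof (intro sum_mono)
    fix k l assume "k \<in> {..d}" "l \<in> {..d}"
    then have "M l * F (u k) (v l) \<ge> 0" using M[of l] sgn(2)[of k l] by simp
    from mult_right_mono[OF MZ[of k] this] show "3 / 4 * (M k * M l * F (u k) (v l)) \<le> Z k * M l * F (u k) (v l)"
      by (simp add: mult_ac)
  qed
  moreover have "T Z M v v \<le> 3 / 4 * T M M v v"
    unfolding T_def sum_distrib_left
  proof (intro sum_mono)
    fix k l assume "k \<in> {..d}" "l \<in> {..d}"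
    then have "M l * F (v k) (v l) \<le> 0" using M[of l] sgn(1)[of k l] by (simp add: mult_le_0_iff)
    from mult_right_mono_neg[OF MZ[of k] this] show "Z k * M l * F (v k) (v l) \<le> 3 / 4 * (M k * M l * F (v k) (v l))"
      by (simp add: mult_ac)
  qed
  moreover have "T M Z v v \<le> 3 / 4 * T M M v v"
    unfolding T_def sum_distrib_left
  proof (intro sum_mono)
    fix k l assume "k \<in> {..d}" "l \<in> {..d}"
    then have "M k * F (v k) (v l) \<le> 0" using M[of k] sgn(1)[of k l] by (simp add: mult_le_0_iff)
    from mult_right_mono_neg[OF MZ[of l] this] show "M k * Z l * F (v k) (v l) \<le> 3 / 4 * (M k * M l * F (v k) (v l))"
      by (simp add: mult_ac)
  qed
  moreover have "T M M v v \<le> 0"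
    unfolding T_def using sgn
    by (auto intro!: sum_nonpos mult_nonneg_nonpos mult_nonneg_nonneg less_imp_le[OF M] intro: less_imp_le)
  \<comment> \<open>Let E be \<open>- T M M v v\<close>. \<open>NM\<close> and \<open>MN\<close>
    give \<open>T M M u v\<close> and \<open>T M M v u\<close> at least 3/4 E, and \<open>NN\<close>
    then forces E > 3/4 (3/4 E + 3/4 E) = 9/8 E, although E >= 0.\<close>
  ultimately show False using NN NM MN ge0 by linarith
qed

section \<open>Averages over slices of the cube\<close>

text \<open>A point of a cube is encoded by the set \<open>A\<close> of its coordinates equal to \<open>-1\<close>, which turns
  the parity of the coordinates in \<open>Q\<close> into \<open>chr Q A\<close>.\<close>

definition chr :: "'a set \<Rightarrow> 'a set \<Rightarrow> real" where
  "chr Q A = (\<Prod>p\<in>A. if p \<in> Q then -1 else 1)"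

lemma chr_Un_disjoint:
  assumes "finite A" "finite B" "A \<inter> B = {}"
  shows "chr Q (A \<union> B) = chr Q A * chr Q B"
  unfolding chr_def by (rule prod.union_disjoint[OF assms])

text \<open>The sum factors over \<open>R\<close>, and an element of \<open>Q\<close> contributes
  \<open>-1 + 1\<close>.\<close>

lemma sum_chr_Pow_eq_0:
  assumes "finite R" "Q \<inter> R \<noteq> {}"
  shows "(\<Sum>A\<in>Pow R. chr Q A) = 0"
proof -
  have "(\<Sum>A\<in>Pow R. chr Q A) = (\<Prod>p\<in>R. (if p \<in> Q then -1 else 1) + 1 :: real)"
    using assms(1) by (simp add: prod_add chr_def)
  also have "\<dots> = 0" using assms by (auto intro!: prod_zero)
  finally show ?thesis .
qed

text \<open>In the set encoding, this is the layer of the cube on \<open>U\<close> with coordinate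
  sum \<open>card U - 2 * a\<close>.\<close>

definition slice :: "'a set \<Rightarrow> nat \<Rightarrow> 'a set set" where
  "slice U a = {A. A \<subseteq> U \<and> card A = a}"

lemma finite_slice: "finite U \<Longrightarrow> finite (slice U a)"
  unfolding slice_def by (rule finite_subset[of _ "Pow U"]) auto

text \<open>The direct count is \<open>(card U - card T) choose (a - card T)\<close>. Rewritten this
  way, it is a factor common to all \<open>T\<close> times a polynomial in \<open>a\<close> of
  degree \<open>card T\<close>.\<close>

lemma card_slice_supersets:
  assumes fin: "finite U" and T: "T \<subseteq> U"
  shows "real (card {A \<in> slice U a. T \<subseteq> A}) = real (card U choose a) * real (a choose card T) / real (card U choose card T)"
proof (cases "card T \<le> a \<and> a \<le> card U")
  case True
  have finT: "finite T" using fin T finite_subset by blast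
  have "bij_betw (\<lambda>B. B \<union> T) {B. B \<subseteq> U - T \<and> card B = a - card T} {A \<in> slice U a. T \<subseteq> A}"
  proof (rule bij_betw_byWitness[where f' = "\<lambda>A. A - T"])
    show "(\<lambda>B. B \<union> T) ` {B. B \<subseteq> U - T \<and> card B = a - card T} \<subseteq> {A \<in> slice U a. T \<subseteq> A}"
    proof safe
      fix B assume B: "B \<subseteq> U - T" "card B = a - card T"
      then have "card (B \<union> T) = a"
        using True finT fin by (subst card_Un_disjoint) (auto intro: finite_subset)
      then show "B \<union> T \<in> slice U a" using B T by (auto simp: slice_def)
    qed
    show "(\<lambda>A. A - T) ` {A \<in> slice U a. T \<subseteq> A} \<subseteq> {B. B \<subseteq> U - T \<and> card B = a - card T}"
      using finT by (auto simp: slice_def card_Diff_subset)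
  qed auto
  then have "card {A \<in> slice U a. T \<subseteq> A} = card {B. B \<subseteq> U - T \<and> card B = a - card T}"
    by (rule bij_betw_same_card[symmetric])
  also have "\<dots> = (card U - card T) choose (a - card T)"
    using fin finT T by (subst n_subsets) (auto simp: card_Diff_subset)
  finally have "real (card {A \<in> slice U a. T \<subseteq> A}) * real (card U choose card T)
      = real (card U choose a) * real (a choose card T)"
    using choose_mult[of "card T" a "card U"] True by (simp flip: of_nat_mult)
  then show ?thesis using card_mono[OF fin T] by (simp add: field_simps)
next
  case False
  have "{A \<in> slice U a. T \<subseteq> A} = {}"
  proof (rule equals0I)
    fix A assume "A \<in> {A \<in> slice U a. T \<subseteq> A}"
    then have A: "A \<subseteq> U" "card A = a" "T \<subseteq> A" by (auto simp: slice_def)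
    then have "card T \<le> card A" using fin by (meson card_mono finite_subset)
    then show False using A card_mono[OF fin A(1)] False by simp
  qed
  moreover have "(card U choose a) * (a choose card T) = 0"
    using False by (auto simp: binomial_eq_0)
  ultimately show ?thesis by (simp only: card.empty of_nat_0 div_0 flip: of_nat_mult)
qed

lemma ex_poly_binomial:
  "\<exists>q :: real poly. degree q \<le> t \<and> (\<forall>a::nat. poly q (real a) = real (a choose t))"
proof (intro exI conjI allI)
  let ?q = "smult (1 / fact t) (\<Prod>i<t. [:- real i, 1:])"
  show "degree ?q \<le> t"
    using degree_prod_sum_le[of "{..<t}" "\<lambda>i. [:- real i, 1:]"]
    by (intro order.trans[OF degree_smult_le]) simp
  show "poly ?q (real a) = real (a choose t)" for a
    by (simp add: poly_prod binomial_gbinomial gbinomial_prod_rev lessThan_atLeast0)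
qed

text \<open>Minsky-Papert symmetrization: expanding each factor of \<open>chr Q A\<close> as 1 plus
  \<open>-2\<close> or \<open>0\<close> leaves only sets \<open>T\<close> inside \<open>Q\<close>,
  hence of size at most \<open>d\<close>. For each of them the supersets in the slice are counted by
  a polynomial of degree \<open>card T\<close>.\<close>

lemma sum_chr_slice_poly:
  assumes fin: "finite U" and Q: "card (Q \<inter> U) \<le> d"
  shows "\<exists>q :: real poly. degree q \<le> d \<and>
    (\<forall>a. (\<Sum>A\<in>slice U a. chr Q A) = real (card U choose a) * poly q (real a))"
proof -
  define g :: "'a set \<Rightarrow> real" where "g T = (\<Prod>p\<in>T. if p \<in> Q then -2 else 0)" for T
  obtain b :: "nat \<Rightarrow> real poly" where b: "\<And>t. degree (b t) \<le> t"
    "\<And>t a. poly (b t) (real a) = real (a choose t)"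
    using ex_poly_binomial by metis
  define q where "q = (\<Sum>T\<in>Pow U. smult (g T / real (card U choose card T)) (b (card T)))"
  have g0: "g T = 0" if "T \<subseteq> U" "card T > d" for T
  proof -
    have "\<not> T \<subseteq> Q \<inter> U" using that Q card_mono[of "Q \<inter> U" T] fin by auto
    then show ?thesis using that fin unfolding g_def by (intro prod_zero) (auto intro: finite_subset)
  qed
  have "degree q \<le> d"
    unfolding q_def
  proof (intro degree_sum_le)
    fix T assume "T \<in> Pow U"
    then show "degree (smult (g T / real (card U choose card T)) (b (card T))) \<le> d"
      using g0[of T] b(1)[of "card T"] by (cases "card T > d") auto
  qed (use fin in auto)
  moreover have "(\<Sum>A\<in>slice U a. chr Q A) = real (card U choose a) * poly q (real a)" for a
  proof -
    have "chr Q A = (\<Sum>T\<in>Pow U. if T \<subseteq> A then g T else 0)" if "A \<in> slice U a" for A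
    proof -
      have A: "A \<subseteq> U" "finite A" using that fin by (auto simp: slice_def intro: finite_subset)
      have "chr Q A = (\<Prod>p\<in>A. (if p \<in> Q then -2 else 0) + 1)"
        unfolding chr_def by (intro prod.cong) auto
      also have "\<dots> = (\<Sum>T\<in>Pow A. g T)" using A by (simp add: prod_add g_def)
      also have "\<dots> = (\<Sum>T\<in>Pow U. if T \<subseteq> A then g T else 0)"
        using A fin by (intro sum.mono_neutral_cong_left) auto
      finally show ?thesis .
    qed
    then have "(\<Sum>A\<in>slice U a. chr Q A) = (\<Sum>A\<in>slice U a. \<Sum>T\<in>Pow U. if T \<subseteq> A then g T else 0)"
      by simp
    also have "\<dots> = (\<Sum>T\<in>Pow U. \<Sum>A\<in>slice U a. if T \<subseteq> A then g T else 0)"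
      by (rule sum.swap)
    also have "\<dots> = (\<Sum>T\<in>Pow U. g T * real (card {A \<in> slice U a. T \<subseteq> A}))"
      using finite_slice[OF fin] by (simp add: sum.If_cases Int_def mult.commute)
    also have "\<dots> = real (card U choose a) * poly q (real a)"
      using fin by (simp add: q_def poly_sum b(2) sum_distrib_left card_slice_supersets mult_ac)
    finally show ?thesis .
  qed
  ultimately show ?thesis by blast
qed

section \<open>Random restriction to selected pairs\<close>

text \<open>Pair \<open>P\<close> has position \<open>P mod k\<close> in group
  \<open>P div k\<close>, so each group contributes the single pair
  \<open>g * k + \<sigma> g\<close>.\<close>

lemma card_selected:
  fixes k :: nat
  assumes "\<And>g. g \<in> {u..<w} \<Longrightarrow> \<sigma> g < k"
  shows "card {P \<in> {u * k..<w * k}. P mod k = \<sigma> (P div k)} = w - u"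
proof -
  have "bij_betw (\<lambda>g. g * k + \<sigma> g) {u..<w} {P \<in> {u * k..<w * k}. P mod k = \<sigma> (P div k)}"
  proof (rule bij_betw_byWitness[where f' = "\<lambda>P. P div k"])
    show "\<forall>g\<in>{u..<w}. (g * k + \<sigma> g) div k = g" using assms by force
    show "\<forall>P\<in>{P \<in> {u * k..<w * k}. P mod k = \<sigma> (P div k)}. P div k * k + \<sigma> (P div k) = P"
      by (metis (mono_tags, lifting) div_mult_mod_eq mem_Collect_eq)
    show "(\<lambda>P. P div k) ` {P \<in> {u * k..<w * k}. P mod k = \<sigma> (P div k)} \<subseteq> {u..<w}"
      by (auto simp: less_mult_imp_div_less) (metis div_le_mono div_mult_self_is_m gr0I less_nat_zero_code mult_0_right)
    show "(\<lambda>g. g * k + \<sigma> g) ` {u..<w} \<subseteq> {P \<in> {u * k..<w * k}. P mod k = \<sigma> (P div k)}"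
    proof safe
      fix g assume g: "g \<in> {u..<w}"
      then have "\<sigma> g < k" using assms by blast
      moreover have "u * k \<le> g * k" using g by simp
      moreover have "Suc g * k \<le> w * k" using g by (intro mult_le_mono1) auto
      ultimately show "g * k + \<sigma> g \<in> {u * k..<w * k}"
        unfolding atLeastLessThan_iff mult_Suc by linarith
      show "(g * k + \<sigma> g) mod k = \<sigma> ((g * k + \<sigma> g) div k)"
        using \<open>\<sigma> g < k\<close> by simp
    qed
  qed
  then show ?thesis using bij_betw_same_card by fastforce
qed

text \<open>If some selector picks all of \<open>Q\<close>, its elements lie in distinct groups, so
  \<open>card Q\<close> values of the selector are forced and the others are free.\<close>

lemma card_selectors_containing:
  fixes k :: nat
  assumes Q: "Q \<subseteq> {..<g * k}" "card Q > d"
  shows "card {\<sigma> \<in> {..<g} \<rightarrow>\<^sub>E {..<k}. \<forall>P\<in>Q. P mod k = \<sigma> (P div k)} * k ^ (d + 1) \<le> k ^ g"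
proof (cases "{\<sigma> \<in> {..<g} \<rightarrow>\<^sub>E {..<k}. \<forall>P\<in>Q. P mod k = \<sigma> (P div k)} = {}")
  case False
  then obtain \<tau> where \<tau>: "\<tau> \<in> {..<g} \<rightarrow>\<^sub>E {..<k}" "\<And>P. P \<in> Q \<Longrightarrow> P mod k = \<tau> (P div k)" by blast
  define D where "D = (\<lambda>P. P div k) ` Q"
  have finQ: "finite Q" using Q(1) finite_subset by blast
  have Dsub: "D \<subseteq> {..<g}" using Q(1) by (auto simp: D_def less_mult_imp_div_less)
  have "inj_on (\<lambda>P. P div k) Q"
    using \<tau>(2) by (intro inj_onI) (metis div_mult_mod_eq)
  then have cD: "card D = card Q" by (simp add: D_def card_image)
  have kpos: "k > 0"
  proof -
    have "Q \<noteq> {}" using Q(2) by auto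
    then show ?thesis using Q(1) by (cases k) auto
  qed
  have "{\<sigma> \<in> {..<g} \<rightarrow>\<^sub>E {..<k}. \<forall>P\<in>Q. P mod k = \<sigma> (P div k)}
      \<subseteq> (\<Pi>\<^sub>E i\<in>{..<g}. if i \<in> D then {\<tau> i} else {..<k})"
  proof
    fix \<sigma> assume \<sigma>: "\<sigma> \<in> {\<sigma> \<in> {..<g} \<rightarrow>\<^sub>E {..<k}. \<forall>P\<in>Q. P mod k = \<sigma> (P div k)}"
    have "\<sigma> i = \<tau> i" if "i \<in> D" for i using that \<sigma> \<tau>(2) by (fastforce simp: D_def)
    then show "\<sigma> \<in> (\<Pi>\<^sub>E i\<in>{..<g}. if i \<in> D then {\<tau> i} else {..<k})"
      using \<sigma> by (auto simp: PiE_iff)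
  qed
  then have "card {\<sigma> \<in> {..<g} \<rightarrow>\<^sub>E {..<k}. \<forall>P\<in>Q. P mod k = \<sigma> (P div k)}
      \<le> card (\<Pi>\<^sub>E i\<in>{..<g}. if i \<in> D then {\<tau> i} else {..<k})"
    by (intro card_mono finite_PiE) auto
  also have "\<dots> = (\<Prod>i<g. if i \<in> D then 1 else k)"
    by (subst card_PiE) (auto intro!: prod.cong)
  also have "\<dots> = k ^ card ({..<g} - D)"
    by (simp add: prod.If_cases Diff_eq)
  also have "card ({..<g} - D) = g - card Q"
    using Dsub cD finite_subset[OF Dsub] by (simp add: card_Diff_subset)
  finally have "card {\<sigma> \<in> {..<g} \<rightarrow>\<^sub>E {..<k}. \<forall>P\<in>Q. P mod k = \<sigma> (P div k)} * k ^ (d + 1)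
      \<le> k ^ (g - card Q) * k ^ (d + 1)"
    by (rule mult_right_mono) simp
  also have "\<dots> = k ^ (g - card Q + (d + 1))" by (simp only: power_add)
  also have "\<dots> \<le> k ^ g"
    using kpos Q(2) card_mono[OF _ Dsub] cD by (intro power_increasing) auto
  finally show ?thesis .
next
  case True
  then show ?thesis by (simp only: card.empty mult_0 le0)
qed

text \<open>Union bound: the bad selectors for each \<open>i\<close> number at most a fraction
  \<open>1 / k ^ (d + 1)\<close> of all \<open>k ^ g\<close>.\<close>

lemma ex_avoiding_selector:
  fixes k :: nat and Q :: "nat \<Rightarrow> nat set"
  assumes Q: "\<And>i. i \<in> {1..K} \<Longrightarrow> Q i \<subseteq> {..<g * k}" and K: "K < k ^ (d + 1)"
  shows "\<exists>\<sigma>\<in>{..<g} \<rightarrow>\<^sub>E {..<k}.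
    \<forall>i\<in>{1..K}. (\<forall>P\<in>Q i. P mod k = \<sigma> (P div k)) \<longrightarrow> card (Q i) \<le> d"
proof -
  define B where "B i = {\<sigma> \<in> {..<g} \<rightarrow>\<^sub>E {..<k}. (\<forall>P\<in>Q i. P mod k = \<sigma> (P div k)) \<and> card (Q i) > d}" for i
  have B: "card (B i) * k ^ (d + 1) \<le> k ^ g" if "i \<in> {1..K}" for i
  proof (cases "card (Q i) > d")
    case True
    then show ?thesis using card_selectors_containing[OF Q[OF that] True] by (simp add: B_def)
  qed (simp add: B_def)
  have kpos: "k > 0" using K by (cases k) auto
  have "card (\<Union>i\<in>{1..K}. B i) * k ^ (d + 1) \<le> (\<Sum>i\<in>{1..K}. card (B i) * k ^ (d + 1))"
    unfolding sum_distrib_right[symmetric] by (intro mult_right_mono card_UN_le) auto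
  also have "\<dots> \<le> (\<Sum>i\<in>{1..K}. k ^ g)" by (intro sum_mono B)
  also have "\<dots> = K * k ^ g" by simp
  also have "\<dots> < k ^ (d + 1) * k ^ g" using K kpos by simp
  finally have lt: "card (\<Union>i\<in>{1..K}. B i) < k ^ g" by (simp add: mult.commute)
  have "\<not> ({..<g} \<rightarrow>\<^sub>E {..<k}) \<subseteq> (\<Union>i\<in>{1..K}. B i)"
  proof
    assume sub: "({..<g} \<rightarrow>\<^sub>E {..<k}) \<subseteq> (\<Union>i\<in>{1..K}. B i)"
    have "finite (B i)" for i
      by (rule finite_subset[of _ "{..<g} \<rightarrow>\<^sub>E {..<k}"]) (auto simp: B_def intro!: finite_PiE)
    then have "card ({..<g} \<rightarrow>\<^sub>E {..<k}) \<le> card (\<Union>i\<in>{1..K}. B i)"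
      using sub by (intro card_mono) auto
    then show False using lt by (simp add: card_PiE)
  qed
  then obtain \<sigma> where \<sigma>: "\<sigma> \<in> {..<g} \<rightarrow>\<^sub>E {..<k}" "\<And>i. i \<in> {1..K} \<Longrightarrow> \<sigma> \<notin> B i" by blast
  show ?thesis
  proof (intro bexI[OF _ \<sigma>(1)] ballI impI)
    fix i assume "i \<in> {1..K}" "\<forall>P\<in>Q i. P mod k = \<sigma> (P div k)"
    then show "card (Q i) \<le> d" using \<sigma>(1) \<sigma>(2)[of i] by (simp add: B_def not_less)
  qed
qed

section \<open>Points of the cube determined by selected pairs\<close>

definition coord :: "nat set \<Rightarrow> nat \<Rightarrow> real" where
  "coord A P = (if P \<in> A then -1 else 1)"

text \<open>Coordinates \<open>2q + 1\<close> and \<open>2q + 2\<close> form the pair \<open>off + q\<close>: they are equal if the pair lies in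
  \<open>Sel\<close> and opposite otherwise. The coordinates beyond \<open>2m\<close> are constants that nearly cancel.\<close>

definition paired_block :: "nat \<Rightarrow> nat set \<Rightarrow> nat set \<Rightarrow> nat \<Rightarrow> nat \<Rightarrow> real" where
  "paired_block m Sel A off l =
     (if l \<le> 2 * m
      then (if odd l \<or> off + (l - 1) div 2 \<in> Sel then 1 else -1) * coord A (off + (l - 1) div 2)
      else (-1) ^ l)"

definition paired_point :: "nat \<Rightarrow> nat \<Rightarrow> nat set \<Rightarrow> nat set \<Rightarrow> nat \<Rightarrow> real" where
  "paired_point n m Sel A =
     (\<lambda>i\<in>{1..2 * n}. if i \<le> n then paired_block m Sel A 0 i else paired_block m Sel A m (i - n))"

text \<open>The value \<open>2 * m\<close> is a dummy pair for the constant coordinates: it lies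
  outside every \<open>A \<subseteq> {..<2 * m}\<close>.\<close>

definition pair_index :: "nat \<Rightarrow> nat \<Rightarrow> nat \<Rightarrow> nat" where
  "pair_index n m i =
     (if i \<le> n then if i \<le> 2 * m then (i - 1) div 2 else 2 * m
      else if i - n \<le> 2 * m then m + (i - n - 1) div 2 else 2 * m)"

lemma paired_point_in_cube: "paired_point n m Sel A \<in> cube (2 * n)"
proof -
  have "paired_block m Sel A off l \<in> {-1, 1}" for off l
    using neg_one_even_power[of l] neg_one_odd_power[of l]
    by (cases "even l") (auto simp: paired_block_def coord_def)
  then show ?thesis by (auto simp: cube_def paired_point_def)
qed

lemma sum_coord:
  assumes "finite U"
  shows "(\<Sum>P\<in>U. coord A P) = real (card U) - 2 * real (card (A \<inter> U))"
proof -
  have "(\<Sum>P\<in>U. coord A P) = (\<Sum>P\<in>U. 1 - (if P \<in> A then 2 else 0))"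
    by (intro sum.cong) (auto simp: coord_def)
  also have "\<dots> = real (card U) - 2 * real (card (A \<inter> U))"
    using assms by (simp add: sum_subtractf sum.If_cases Int_commute)
  finally show ?thesis .
qed

text \<open>Unselected pairs cancel and selected ones count twice. The constant tail alternates
  starting with \<open>-1\<close>, so it sums to \<open>-1\<close> or \<open>0\<close>.\<close>

lemma sum_paired_block:
  assumes "2 * m \<le> n"
  shows "(\<Sum>l=1..n. paired_block m Sel A off l) - 2 * (\<Sum>P\<in>Sel \<inter> {off..<off + m}. coord A P) \<in> {-1, 0}"
proof -
  have pairs: "(\<Sum>l=1..2 * r. f l) = (\<Sum>q<r. f (2 * q + 1) + f (2 * q + 2))" for f :: "nat \<Rightarrow> real" and r
    by (induction r) (auto simp: numeral_2_eq_2)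
  have alt: "(\<Sum>l=Suc (2 * m)..2 * m + r. (-1 :: real) ^ l) = (if even r then 0 else -1)" for r
    by (induction r) auto
  have split: "{1..n} = {1..2 * m} \<union> {Suc (2 * m)..n}" using assms by auto
  have "(\<Sum>l=1..n. paired_block m Sel A off l)
      = (\<Sum>l=1..2 * m. paired_block m Sel A off l) + (\<Sum>l=Suc (2 * m)..n. paired_block m Sel A off l)"
    unfolding split by (rule sum.union_disjoint) auto
  also have "(\<Sum>l=Suc (2 * m)..n. paired_block m Sel A off l) = (\<Sum>l=Suc (2 * m)..2 * m + (n - 2 * m). (-1) ^ l)"
    using assms by (intro sum.cong) (auto simp: paired_block_def)
  also have "(\<Sum>l=1..2 * m. paired_block m Sel A off l) = (\<Sum>q<m. if off + q \<in> Sel then 2 * coord A (off + q) else 0)"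
    unfolding pairs by (intro sum.cong) (auto simp: paired_block_def)
  also have "\<dots> = (\<Sum>P\<in>{off..<off + m}. if P \<in> Sel then 2 * coord A P else 0)"
    by (rule sum.reindex_bij_witness[of _ "\<lambda>P. P - off" "\<lambda>q. off + q"]) auto
  also have "\<dots> = 2 * (\<Sum>P\<in>Sel \<inter> {off..<off + m}. coord A P)"
    by (simp add: sum.If_cases sum_distrib_left Int_commute)
  finally show ?thesis unfolding alt by simp
qed

text \<open>Each block sums to four times \<open>H - a\<close> (or \<open>H - b\<close>), up to an
  error of \<open>-1\<close> or \<open>0\<close>. Off the middle layer this error cannot change the
  sign.\<close>

lemma maj_and_maj_paired_point:
  assumes "2 * m \<le> n"
    and "card (Sel \<inter> {..<m}) = 2 * H" "card (Sel \<inter> {m..<2 * m}) = 2 * H"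
    and "card (A \<inter> (Sel \<inter> {..<m})) = a" "card (A \<inter> (Sel \<inter> {m..<2 * m})) = b" "a \<noteq> H" "b \<noteq> H"
  shows "maj_and_maj n (paired_point n m Sel A) = (if a > H \<and> b > H then -1 else 1)"
proof -
  have maj: "(s > 0 \<longleftrightarrow> c < H)" if "s - 2 * (real (2 * H) - 2 * real c) \<in> {-1, 0}" "c \<noteq> H" for s c
  proof (cases "c < H")
    case True
    then have "real c + 1 \<le> real H" by simp
    then show ?thesis using that True by auto
  next
    case False
    then have "real H + 1 \<le> real c" using that by simp
    then show ?thesis using that False by auto
  qed
  have s0: "(\<Sum>i=1..n. paired_point n m Sel A i) = (\<Sum>l=1..n. paired_block m Sel A 0 l)"
    by (intro sum.cong) (auto simp: paired_point_def)
  have s1: "(\<Sum>i=1..n. paired_point n m Sel A (n + i)) = (\<Sum>l=1..n. paired_block m Sel A m l)"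
    by (intro sum.cong) (auto simp: paired_point_def)
  have c0: "(\<Sum>P\<in>Sel \<inter> {0..<0 + m}. coord A P) = real (2 * H) - 2 * real a"
    using assms by (simp add: sum_coord lessThan_atLeast0)
  have c1: "(\<Sum>P\<in>Sel \<inter> {m..<m + m}. coord A P) = real (2 * H) - 2 * real b"
    using assms by (simp add: sum_coord flip: mult_2)
  have "(\<Sum>i=1..n. paired_point n m Sel A i) > 0 \<longleftrightarrow> a < H"
    unfolding s0 by (rule maj[OF sum_paired_block[OF assms(1), of Sel A 0, unfolded c0] assms(6)])
  moreover have "(\<Sum>i=1..n. paired_point n m Sel A (n + i)) > 0 \<longleftrightarrow> b < H"
    unfolding s1 by (rule maj[OF sum_paired_block[OF assms(1), of Sel A m, unfolded c1] assms(7)])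
  ultimately show ?thesis using assms(6,7)
    by (auto simp: maj_and_maj_def AND_def MAJ_def)
qed

text \<open>Squares of coordinates are 1, so only the parity of the number of variables of
  \<open>S\<close> in each pair matters.\<close>

lemma prod_coord_eq_chr:
  assumes fin: "finite S" and \<pi>: "\<And>i. i \<in> S \<Longrightarrow> \<pi> i \<le> t" and A: "A \<subseteq> {..<t}"
  shows "(\<Prod>i\<in>S. coord A (\<pi> i)) = chr {P. P < t \<and> odd (card {i \<in> S. \<pi> i = P})} A"
proof -
  have "(\<Prod>i\<in>S. coord A (\<pi> i)) = (\<Prod>P\<in>{..t}. \<Prod>i\<in>{i \<in> S. \<pi> i = P}. coord A (\<pi> i))"
    using \<pi> by (intro prod.group[symmetric] fin) auto
  also have "\<dots> = (\<Prod>P\<in>{..t}. coord A P ^ card {i \<in> S. \<pi> i = P})"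
    by (intro prod.cong) auto
  also have "\<dots> = (\<Prod>P\<in>A. coord A P ^ card {i \<in> S. \<pi> i = P})"
    using A by (intro prod.mono_neutral_right) (auto simp: coord_def)
  also have "\<dots> = chr {P. P < t \<and> odd (card {i \<in> S. \<pi> i = P})} A"
    unfolding chr_def using A by (intro prod.cong) (auto simp: coord_def)
  finally show ?thesis .
qed

text \<open>Each coordinate is a sign independent of \<open>A\<close> times the \<open>coord\<close>
  of its pair; \<open>e\<close> collects these signs.\<close>

lemma monomial_paired_point:
  assumes S: "S \<subseteq> {1..2 * n}"
  shows "\<exists>e. \<forall>A\<subseteq>{..<2 * m}. (\<Prod>i\<in>S. paired_point n m Sel A i)
    = e * chr {P. P < 2 * m \<and> odd (card {i \<in> S. pair_index n m i = P})} A"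
proof -
  define w where "w i = (if i \<le> n then paired_block m Sel {} 0 i else paired_block m Sel {} m (i - n))" for i
  have fin: "finite S" using S finite_subset by blast
  have "paired_point n m Sel A i = w i * coord A (pair_index n m i)" if "i \<in> S" "A \<subseteq> {..<2 * m}" for i A
  proof -
    have "coord A (2 * m) = 1" using that by (auto simp: coord_def)
    moreover have "coord {} P = 1" for P by (simp add: coord_def)
    moreover have "i \<in> {1..2 * n}" using that S by auto
    ultimately show ?thesis
      by (simp add: paired_point_def w_def paired_block_def pair_index_def)
  qed
  then have "(\<Prod>i\<in>S. paired_point n m Sel A i) = (\<Prod>i\<in>S. w i) * (\<Prod>i\<in>S. coord A (pair_index n m i))"
    if "A \<subseteq> {..<2 * m}" for A
    using that by (simp add: prod.distrib)
  moreover have "pair_index n m i \<le> 2 * m" for i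
    by (auto simp: pair_index_def)
  ultimately have "(\<Prod>i\<in>S. paired_point n m Sel A i)
      = (\<Prod>i\<in>S. w i) * chr {P. P < 2 * m \<and> odd (card {i \<in> S. pair_index n m i = P})} A"
    if "A \<subseteq> {..<2 * m}" for A
    using prod_coord_eq_chr[OF fin _ that] that by simp
  then show ?thesis by blast
qed

section \<open>The lower bound\<close>

lemma sign_representable_maj_and_maj_lower_bound:
  fixes n k d K :: nat
  defines "H \<equiv> 1024 ^ d"
  assumes n: "4 * H * k \<le> n"
    and rep: "sign_representable (2 * n) (maj_and_maj n) K"
  shows "k ^ (d + 1) \<le> K"
proof (rule ccontr)
  assume "\<not> k ^ (d + 1) \<le> K"
  then have K: "K < k ^ (d + 1)" by simp
  \<comment> \<open>Each block gets \<open>2 * H\<close> groups of \<open>k\<close> pairs. With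
    \<open>2 * H\<close> selected pairs, \<open>H - a\<close> ranges over all integers from
    \<open>-H\<close> to \<open>H\<close>, which include every node.\<close>
  define m where "m = 2 * H * k"
  have mn: "2 * m \<le> n" and mk: "2 * m = (4 * H) * k" using n by (auto simp: m_def)
  obtain S l where S: "\<And>i. i \<in> {1..K} \<Longrightarrow> S i \<subseteq> {1..2 * n}"
    and sgn_rep: "\<And>x. x \<in> cube (2 * n) \<Longrightarrow> maj_and_maj n x = sgn (\<Sum>i=1..K. l i * (\<Prod>j\<in>S i. x j))"
    using rep unfolding sign_representable_def by blast
  define Q where "Q i = {P. P < 2 * m \<and> odd (card {j \<in> S i. pair_index n m j = P})}" for i
  have Qsub: "Q i \<subseteq> {..<(4 * H) * k}" for i by (auto simp: Q_def mk[symmetric])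
  obtain \<sigma> where \<sigma>: "\<sigma> \<in> {..<4 * H} \<rightarrow>\<^sub>E {..<k}"
    and avoid: "\<forall>i\<in>{1..K}. (\<forall>P\<in>Q i. P mod k = \<sigma> (P div k)) \<longrightarrow> card (Q i) \<le> d"
    using ex_avoiding_selector[of K Q, OF Qsub K] by (elim bexE)
  have \<sigma>_less: "\<sigma> g < k" if "g < 4 * H" for g
    using PiE_mem[OF \<sigma>, of g] that by simp
  define Sel where "Sel = {P \<in> {..<2 * m}. P mod k = \<sigma> (P div k)}"
  define U where "U = Sel \<inter> {..<m}"
  define V where "V = Sel \<inter> {m..<2 * m}"
  define R where "R = {..<2 * m} - Sel"
  have fin: "finite U" "finite V" "finite R" "finite Sel" by (auto simp: U_def V_def R_def Sel_def)
  have cU: "card U = 2 * H"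
  proof -
    have "U = {P \<in> {0 * k..<(2 * H) * k}. P mod k = \<sigma> (P div k)}" by (auto simp: U_def Sel_def m_def)
    moreover have "card \<dots> = 2 * H - 0" by (rule card_selected) (simp add: \<sigma>_less)
    ultimately show ?thesis by simp
  qed
  have cV: "card V = 2 * H"
  proof -
    have "V = {P \<in> {(2 * H) * k..<(4 * H) * k}. P mod k = \<sigma> (P div k)}" by (auto simp: V_def Sel_def m_def)
    moreover have "card \<dots> = 4 * H - 2 * H" by (rule card_selected) (simp add: \<sigma>_less)
    ultimately show ?thesis by simp
  qed
  have "\<exists>e. \<forall>A\<subseteq>{..<2 * m}. (\<Prod>j\<in>S i. paired_point n m Sel A j) = e * chr (Q i) A" if "i \<in> {1..K}" for i
    unfolding Q_def by (rule monomial_paired_point[OF S[OF that]])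
  then obtain e where e: "\<And>i A. i \<in> {1..K} \<Longrightarrow> A \<subseteq> {..<2 * m} \<Longrightarrow>
      (\<Prod>j\<in>S i. paired_point n m Sel A j) = e i * chr (Q i) A" by metis
  \<comment> \<open>Only these parities survive averaging over the signs of the unselected
    pairs.\<close>
  define I where "I = {i \<in> {1..K}. Q i \<subseteq> Sel}"
  have degQ: "card (Q i) \<le> d" "finite (Q i)" if "i \<in> I" for i
    using that avoid by (auto simp: I_def Sel_def Q_def)
  have "\<exists>p :: real poly. degree p \<le> d \<and> (\<forall>a. (\<Sum>A\<in>slice U a. chr (Q i) A) = real (card U choose a) * poly p (real a))"
    if "i \<in> I" for i
    using degQ[OF that] card_mono[of "Q i" "Q i \<inter> U"] by (intro sum_chr_slice_poly fin) auto
  then obtain p where p: "\<And>i. i \<in> I \<Longrightarrow> degree (p i) \<le> d"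
    "\<And>i a. i \<in> I \<Longrightarrow> (\<Sum>A\<in>slice U a. chr (Q i) A) = real (2 * H choose a) * poly (p i) (real a)"
    unfolding cU by metis
  have "\<exists>p :: real poly. degree p \<le> d \<and> (\<forall>a. (\<Sum>A\<in>slice V a. chr (Q i) A) = real (card V choose a) * poly p (real a))"
    if "i \<in> I" for i
    using degQ[OF that] card_mono[of "Q i" "Q i \<inter> V"] by (intro sum_chr_slice_poly fin) auto
  then obtain r where r: "\<And>i. i \<in> I \<Longrightarrow> degree (r i) \<le> d"
    "\<And>i a. i \<in> I \<Longrightarrow> (\<Sum>A\<in>slice V a. chr (Q i) A) = real (2 * H choose a) * poly (r i) (real a)"
    unfolding cV by metis
  define c where "c i = l i * e i * (\<Sum>C\<in>Pow R. chr (Q i) C)" for i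
  \<comment> \<open>Passing from \<open>a\<close> to \<open>H - a\<close>, half the coordinate sum
    on the selected pairs, centres the polynomials at the tie.\<close>
  define flip where "flip = [:real H, -1:]"
  define F where "F x y = (\<Sum>i\<in>I. c i * poly (p i \<circ>\<^sub>p flip) x * poly (r i \<circ>\<^sub>p flip) y)" for x y
  define f where "f A = (\<Sum>i=1..K. l i * (\<Prod>j\<in>S i. paired_point n m Sel A j))" for A
  define \<Phi> where "\<Phi> a b = (\<Sum>A\<in>slice U a. \<Sum>B\<in>slice V b. \<Sum>C\<in>Pow R. f (A \<union> B \<union> C))" for a b
  have \<Phi>_F: "\<Phi> a b = real (2 * H choose a) * real (2 * H choose b) * F (real H - real a) (real H - real b)" for a b
  proof -
    have chr3: "f (A \<union> B \<union> C) = (\<Sum>i=1..K. l i * e i * (chr (Q i) A * chr (Q i) B * chr (Q i) C))"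
      if "A \<in> slice U a" "B \<in> slice V b" "C \<in> Pow R" for A B C
    proof -
      have sub: "A \<subseteq> U" "B \<subseteq> V" "C \<subseteq> R" using that by (auto simp: slice_def)
      then have finABC: "finite A" "finite B" "finite C" using fin finite_subset by blast+
      moreover have "A \<inter> B = {}" "(A \<union> B) \<inter> C = {}"
        using sub by (fastforce simp: U_def V_def R_def)+
      ultimately have "chr X (A \<union> B \<union> C) = chr X A * chr X B * chr X C" for X
        by (simp add: chr_Un_disjoint)
      moreover have "A \<union> B \<union> C \<subseteq> {..<2 * m}" using sub by (auto simp: U_def V_def R_def)
      ultimately show ?thesis by (simp add: f_def e mult.assoc)
    qed
    have "\<Phi> a b = (\<Sum>A\<in>slice U a. \<Sum>B\<in>slice V b. \<Sum>C\<in>Pow R. \<Sum>i=1..K.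
        l i * e i * (chr (Q i) A * chr (Q i) B * chr (Q i) C))"
      unfolding \<Phi>_def by (intro sum.cong refl chr3)
    also have "\<dots> = (\<Sum>i=1..K. \<Sum>A\<in>slice U a. \<Sum>B\<in>slice V b. \<Sum>C\<in>Pow R.
        l i * e i * (chr (Q i) A * chr (Q i) B * chr (Q i) C))"
      by (simp only: sum.swap[of _ "{1..K}"])
    also have "\<dots> = (\<Sum>i=1..K. c i * (\<Sum>A\<in>slice U a. chr (Q i) A) * (\<Sum>B\<in>slice V b. chr (Q i) B))"
      by (intro sum.cong refl) (simp add: c_def mult_ac flip: sum_distrib_left sum_distrib_right)
    also have "\<dots> = (\<Sum>i\<in>I. c i * (\<Sum>A\<in>slice U a. chr (Q i) A) * (\<Sum>B\<in>slice V b. chr (Q i) B))"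
    proof (intro sum.mono_neutral_right ballI)
      fix i assume "i \<in> {1..K} - I"
      then have "Q i \<inter> R \<noteq> {}" by (auto simp: I_def R_def Q_def)
      then have "c i = 0" using sum_chr_Pow_eq_0[OF fin(3)] by (simp add: c_def)
      then show "c i * (\<Sum>A\<in>slice U a. chr (Q i) A) * (\<Sum>B\<in>slice V b. chr (Q i) B) = 0" by simp
    qed (auto simp: I_def)
    also have "\<dots> = (\<Sum>i\<in>I. real (2 * H choose a) * real (2 * H choose b) *
        (c i * poly (p i \<circ>\<^sub>p flip) (real H - real a) * poly (r i \<circ>\<^sub>p flip) (real H - real b)))"
      by (intro sum.cong refl) (simp add: p(2) r(2) flip_def poly_pcompose mult_ac)
    also have "\<dots> = real (2 * H choose a) * real (2 * H choose b) * F (real H - real a) (real H - real b)"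
      unfolding F_def by (rule sum_distrib_left[symmetric])
    finally show ?thesis .
  qed
  \<comment> \<open>All points averaged in \<open>\<Phi> a b\<close> have the same function value,
    so the average inherits the sign.\<close>
  have sign: "(if a > H \<and> b > H then -1 else 1) * F (real H - real a) (real H - real b) > 0"
    if ab: "a \<le> 2 * H" "b \<le> 2 * H" "a \<noteq> H" "b \<noteq> H" for a b
  proof -
    define s :: real where "s = (if a > H \<and> b > H then -1 else 1)"
    have pos: "s * f (A \<union> B \<union> C) > 0" if "A \<in> slice U a" "B \<in> slice V b" "C \<in> Pow R" for A B C
    proof -
      let ?A = "A \<union> B \<union> C"
      have sub: "A \<subseteq> U" "B \<subseteq> V" "C \<subseteq> R" "card A = a" "card B = b" using that by (auto simp: slice_def)
      then have "?A \<inter> (Sel \<inter> {..<m}) = A" "?A \<inter> (Sel \<inter> {m..<2 * m}) = B"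
        by (auto simp: U_def V_def R_def)
      then have "maj_and_maj n (paired_point n m Sel ?A) = s"
        unfolding s_def using cU cV sub ab by (intro maj_and_maj_paired_point[OF mn]) (auto simp: U_def V_def)
      then have "s = sgn (f ?A)"
        using sgn_rep[OF paired_point_in_cube] by (simp add: f_def)
      moreover have "s \<noteq> 0" by (simp add: s_def)
      ultimately show ?thesis by (metis abs_sgn mult.commute sgn_0 zero_less_abs_iff)
    qed
    have ne: "slice U a \<noteq> {}" "slice V b \<noteq> {}"
      using ab obtain_subset_with_card_n[of a U] obtain_subset_with_card_n[of b V] cU cV
      by (auto simp: slice_def)
    have "s * \<Phi> a b = (\<Sum>A\<in>slice U a. \<Sum>B\<in>slice V b. \<Sum>C\<in>Pow R. s * f (A \<union> B \<union> C))"
      by (simp add: \<Phi>_def sum_distrib_left)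
    also have "\<dots> > 0"
      using ne pos fin by (intro sum_pos finite_slice) auto
    finally have "real (2 * H choose a) * real (2 * H choose b) * (s * F (real H - real a) (real H - real b)) > 0"
      by (simp add: \<Phi>_F mult_ac)
    moreover have "real (2 * H choose a) * real (2 * H choose b) > 0"
      using zero_less_binomial[OF ab(1)] zero_less_binomial[OF ab(2)] by simp
    ultimately show ?thesis unfolding s_def by (simp only: zero_less_mult_pos)
  qed
  have Hk: "1024 ^ j \<le> H" "1024 ^ j > (0::nat)" if "j \<le> d" for j
    unfolding H_def using that by (auto intro: power_increasing)
  have low: "H - 1024 ^ j \<le> 2 * H" "H - 1024 ^ j \<noteq> H" "\<not> H < H - 1024 ^ j" if "j \<le> d" for j
    using Hk[OF that] by linarith+
  have high: "H + 1024 ^ j \<le> 2 * H" "H + 1024 ^ j \<noteq> H" if "j \<le> d" for j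
    using Hk[OF that] by linarith+
  have node: "(1024 :: real) ^ j = real H - real (H - 1024 ^ j)" "- ((1024 :: real) ^ j) = real H - real (H + 1024 ^ j)"
    if "j \<le> d" for j
    using Hk[OF that] by (auto simp: of_nat_diff)
  show False
  proof (rule no_low_degree_intersection_sign_pattern[of I "\<lambda>i. p i \<circ>\<^sub>p flip" d "\<lambda>i. r i \<circ>\<^sub>p flip" F c])
    show "finite I" by (simp add: I_def)
    show "degree (p i \<circ>\<^sub>p flip) \<le> d" "degree (r i \<circ>\<^sub>p flip) \<le> d" if "i \<in> I" for i
      using p(1)[OF that] r(1)[OF that] by (simp_all add: flip_def degree_pcompose)
    show "F x y = (\<Sum>i\<in>I. c i * poly (p i \<circ>\<^sub>p flip) x * poly (r i \<circ>\<^sub>p flip) y)" for x y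
      by (simp add: F_def)
    fix i j assume ij: "i \<le> d" "j \<le> d"
    show "F (- (1024 ^ i)) (- (1024 ^ j)) < 0"
      unfolding node(2)[OF ij(1)] node(2)[OF ij(2)]
      using sign[OF high(1)[OF ij(1)] high(1)[OF ij(2)] high(2)[OF ij(1)] high(2)[OF ij(2)]] Hk[OF ij(1)] Hk[OF ij(2)] by simp
    show "F (1024 ^ i) (1024 ^ j) > 0"
      unfolding node(1)[OF ij(1)] node(1)[OF ij(2)]
      using sign[OF low(1)[OF ij(1)] low(1)[OF ij(2)] low(2)[OF ij(1)] low(2)[OF ij(2)]] low(3)[OF ij(1)] low(3)[OF ij(2)] Hk[OF ij(1)] Hk[OF ij(2)] by simp
    show "F (1024 ^ i) (- (1024 ^ j)) > 0"
      unfolding node(1)[OF ij(1)] node(2)[OF ij(2)]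
      using sign[OF low(1)[OF ij(1)] high(1)[OF ij(2)] low(2)[OF ij(1)] high(2)[OF ij(2)]] low(3)[OF ij(1)] Hk[OF ij(1)] Hk[OF ij(2)] by simp
    show "F (- (1024 ^ i)) (1024 ^ j) > 0"
      unfolding node(2)[OF ij(1)] node(1)[OF ij(2)]
      using sign[OF high(1)[OF ij(1)] low(1)[OF ij(2)] high(2)[OF ij(1)] low(2)[OF ij(2)]] low(3)[OF ij(2)] Hk[OF ij(1)] Hk[OF ij(2)] by simp
  qed
qed

text \<open>The choice \<open>k = 2 ^ d\<close> makes the required length
  \<open>4 * 1024 ^ d * k\<close> equal to \<open>2 ^ (11 * d + 2)\<close>.\<close>

lemma dns_maj_and_maj_lower_bound:
  assumes "2 ^ (11 * d + 2) \<le> n"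
  shows "2 ^ (d * (d + 1)) \<le> dns (2 * n) (maj_and_maj n)"
proof -
  have "\<exists>k. sign_representable (2 * n) (maj_and_maj n) k"
    by (intro ex_sign_representable) (auto simp: maj_and_maj_def AND_def)
  then have "sign_representable (2 * n) (maj_and_maj n) (dns (2 * n) (maj_and_maj n))"
    unfolding dns_def by (metis LeastI)
  moreover have "4 * 1024 ^ d * 2 ^ d \<le> n"
  proof -
    have "(1024::nat) ^ d * 2 ^ d = 2 ^ (11 * d)"
      by (simp add: power_mult flip: power_mult_distrib)
    then show ?thesis using assms by (simp add: power_add mult_ac)
  qed
  ultimately have "(2 ^ d) ^ (d + 1) \<le> dns (2 * n) (maj_and_maj n)"
    by (intro sign_representable_maj_and_maj_lower_bound) auto
  then show ?thesis by (simp only: power_mult)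
qed

theorem theorem6p4:
  shows "\<exists>c>0. \<forall>\<^sub>F n in sequentially.
           real (dns (2 * n) (maj_and_maj n)) \<ge> real n powr (c * log 2 (real n))"
proof (intro exI[of _ "1 / 400"] conjI)
  show "\<forall>\<^sub>F n in sequentially.
      real (dns (2 * n) (maj_and_maj n)) \<ge> real n powr (1 / 400 * log 2 (real n))"
    using eventually_ge_at_top[of "2 ^ 100"]
  proof eventually_elim
    case (elim n)
    define L where "L = log 2 (real n)"
    have n: "real n > 0" using elim by (simp add: order.strict_trans2[of 0 "2 ^ 100"])
    have "real (2 ^ 100) \<le> real n" using elim by (rule of_nat_mono)
    then have L: "L \<ge> 100" using n by (simp add: L_def le_log_iff powr_numeral)
    \<comment> \<open>This is the largest \<open>d\<close> with \<open>11 * d + 2\<close> at most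
      \<open>L\<close>.\<close>
    define d where "d = nat \<lfloor>(L - 2) / 11\<rfloor>"
    have d: "real d \<le> (L - 2) / 11" "(L - 2) / 11 < real d + 1"
    proof -
      have "real d = of_int \<lfloor>(L - 2) / 11\<rfloor>" using L by (simp add: d_def)
      then show "real d \<le> (L - 2) / 11" "(L - 2) / 11 < real d + 1"
        by (simp_all only: of_int_floor_le real_of_int_floor_add_one_gt)
    qed
    have "2 powr real (11 * d + 2) \<le> 2 powr L" using d by (intro powr_mono) auto
    also have "2 powr L = real n" using n by (simp add: L_def)
    finally have "real (2 ^ (11 * d + 2)) \<le> real n"
      by (simp only: powr_realpow zero_less_numeral of_nat_power of_nat_numeral)
    then have "2 ^ (11 * d + 2) \<le> n" by (simp only: of_nat_le_iff)
    from dns_maj_and_maj_lower_bound[OF this]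
    have dns: "2 ^ (d * (d + 1)) \<le> real (dns (2 * n) (maj_and_maj n))"
      by (metis of_nat_le_iff of_nat_numeral of_nat_power)
    \<comment> \<open>The loss from rounding is absorbed because \<open>L\<close> is at least 100;
      squaring \<open>L / 20\<close> produces the constant \<open>1 / 400\<close>.\<close>
    have "L / 20 \<le> real d" using d L by simp
    then have "(L / 20) * (L / 20) \<le> real d * real d" using L by (intro mult_mono) auto
    then have "1 / 400 * L * L \<le> real (d * (d + 1))" by (simp add: algebra_simps)
    then have "2 powr (L * (1 / 400 * L)) \<le> 2 powr real (d * (d + 1))"
      by (intro powr_mono) (auto simp: mult_ac)
    also have "\<dots> = 2 ^ (d * (d + 1))" by (simp only: powr_realpow zero_less_numeral)
    also note dns
    finally have "(2 powr L) powr (1 / 400 * L) \<le> real (dns (2 * n) (maj_and_maj n))"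
      by (simp add: powr_powr)
    then show ?case using n by (simp add: L_def)
  qed
qed simp

end
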